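(* Let $\Omega\subset\mathbb{R}^2$ be a simply connected domain. Let $\lambda_1,\lambda_2\in\mathbb{R}$ and $\epsilon\in\{-1,1\}$ be constants with $\lambda_1^2+\epsilon\lambda_2^2=1$, and let $F:\Omega\to\mathbb{R}$ be a function of class $C^2$ satisfying $$\lambda_1\left(F_{xx}+F_{yy}\right)+\lambda_2\left(1-\epsilon\left(F_{xx}F_{yy}-F_{xy}^2\right)\right)=0\quad\text{on }\Omega.$$ Then the function $h:\Omega\to\mathbb{R}$ defined by $$h(x,y)=\lambda_2F(x,y)-\epsilon\lambda_1\frac{x^2+y^2}{2}$$ satisfies the unimodular Hessian equation $h_{xx}h_{yy}-h_{xy}^2=1$ on $\Omega$.
   Context: Subscripts $x,y$ denote partial derivatives. *)

theory Defs
  imports "HOL-Analysis.Analysis"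
begin

definition partial_x :: "(real \<times> real \<Rightarrow> real) \<Rightarrow> real \<times> real \<Rightarrow> real" where
  "partial_x f = (\<lambda>(x, y). deriv (\<lambda>t. f (t, y)) x)"

definition partial_y :: "(real \<times> real \<Rightarrow> real) \<Rightarrow> real \<times> real \<Rightarrow> real" where
  "partial_y f = (\<lambda>(x, y). deriv (\<lambda>t. f (x, t)) y)"

text \<open>
  Classes of functions with continuous partial derivatives on an open set \<open>S\<close>.
  Since \<^const>\<open>deriv\<close> is total, existence of the partial derivatives is demanded
  explicitly. Values of \<open>f\<close> outside \<open>S\<close> are irrelevant because \<open>S\<close> is open.
\<close>

definition C1_on :: "(real \<times> real) set \<Rightarrow> (real \<times> real \<Rightarrow> real) \<Rightarrow> bool" where
  "C1_on S f \<longleftrightarrow>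
     continuous_on S f \<and>
     (\<forall>(x, y) \<in> S. (\<lambda>t. f (t, y)) field_differentiable (at x) \<and>
                   (\<lambda>t. f (x, t)) field_differentiable (at y)) \<and>
     continuous_on S (partial_x f) \<and> continuous_on S (partial_y f)"

definition C2_on :: "(real \<times> real) set \<Rightarrow> (real \<times> real \<Rightarrow> real) \<Rightarrow> bool" where
  "C2_on S f \<longleftrightarrow> C1_on S f \<and> C1_on S (partial_x f) \<and> C1_on S (partial_y f)"

abbreviation partial_xx :: "(real \<times> real \<Rightarrow> real) \<Rightarrow> real \<times> real \<Rightarrow> real" where
  "partial_xx f \<equiv> partial_x (partial_x f)"

abbreviation partial_xy :: "(real \<times> real \<Rightarrow> real) \<Rightarrow> real \<times> real \<Rightarrow> real" where
  "partial_xy f \<equiv> partial_y (partial_x f)"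

abbreviation partial_yy :: "(real \<times> real \<Rightarrow> real) \<Rightarrow> real \<times> real \<Rightarrow> real" where
  "partial_yy f \<equiv> partial_y (partial_y f)"

end

theory Submission
  imports Defs
begin

text \<open>The Hessian matrix of \<open>h\<close> is \<open>l2\<close> times that of
  \<open>F\<close> minus \<open>\<epsilon> * l1\<close> times the identity. For 2x2 matrices det(s A
  + r I) = s^2 det A + r s tr A + r^2, so the Hessian determinant of \<open>h\<close> involves only
  the determinant and trace of the Hessian of \<open>F\<close>, the two quantities linked by the
  equation. That equation and \<epsilon>^2 = 1 reduce the determinant to l1^2 + \<epsilon> l2^2 = 1.
  The analytic work is linearity of the partial derivatives when the identity for \<open>h\<close>
  is known only on an open set (\<open>partial_x_lincomb\<close>, \<open>partial_y_lincomb\<close>,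
  \<open>C2_on_lincomb\<close>), together with the derivatives of the quadratic term.\<close>

lemma eventually_slice_x:
  fixes S :: "(real \<times> real) set"
  assumes "open S" "(x, y) \<in> S"
  shows "\<forall>\<^sub>F t in nhds x. (t, y) \<in> S"
proof -
  have "((\<lambda>t. (t, y)) \<longlongrightarrow> (x, y)) (nhds x)"
    by (intro tendsto_Pair filterlim_ident tendsto_const)
  then show ?thesis using assms by (rule topological_tendstoD)
qed

lemma eventually_slice_y:
  fixes S :: "(real \<times> real) set"
  assumes "open S" "(x, y) \<in> S"
  shows "\<forall>\<^sub>F t in nhds y. (x, t) \<in> S"
proof -
  have "((\<lambda>t. (x, t)) \<longlongrightarrow> (x, y)) (nhds y)"
    by (intro tendsto_Pair filterlim_ident tendsto_const)
  then show ?thesis using assms by (rule topological_tendstoD)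
qed

lemma C1_on_has_partial_x:
  assumes "C1_on S f" "(x, y) \<in> S"
  shows "((\<lambda>t. f (t, y)) has_field_derivative partial_x f (x, y)) (at x)"
  using assms by (auto simp: C1_on_def partial_x_def field_differentiable_derivI)

lemma C1_on_has_partial_y:
  assumes "C1_on S f" "(x, y) \<in> S"
  shows "((\<lambda>t. f (x, t)) has_field_derivative partial_y f (x, y)) (at y)"
  using assms by (auto simp: C1_on_def partial_y_def field_differentiable_derivI)

lemma partial_x_eqI:
  "((\<lambda>t. f (t, y)) has_field_derivative d) (at x) \<Longrightarrow> partial_x f (x, y) = d"
  by (simp add: partial_x_def DERIV_imp_deriv)

lemma partial_y_eqI:
  "((\<lambda>t. f (x, t)) has_field_derivative d) (at y) \<Longrightarrow> partial_y f (x, y) = d"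
  by (simp add: partial_y_def DERIV_imp_deriv)

text \<open>Derivatives given explicitly on \<open>S\<close> must agree there with
  \<open>partial_x f\<close> and \<open>partial_y f\<close>, by uniqueness of derivatives, so their
  continuity carries over.\<close>

lemma C1_onI:
  assumes f: "continuous_on S f"
    and fx: "\<And>x y. (x, y) \<in> S \<Longrightarrow> ((\<lambda>t. f (t, y)) has_field_derivative fx (x, y)) (at x)"
    and fy: "\<And>x y. (x, y) \<in> S \<Longrightarrow> ((\<lambda>t. f (x, t)) has_field_derivative fy (x, y)) (at y)"
    and cont: "continuous_on S fx" "continuous_on S fy"
  shows "C1_on S f"
proof -
  have "continuous_on S (partial_x f) = continuous_on S fx"
    by (rule continuous_on_cong) (auto intro: partial_x_eqI fx)
  moreover have "continuous_on S (partial_y f) = continuous_on S fy"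
    by (rule continuous_on_cong) (auto intro: partial_y_eqI fy)
  ultimately show ?thesis
    using f fx fy cont by (fastforce simp: C1_on_def field_differentiable_def)
qed

context
  fixes S :: "(real \<times> real) set" and f g h :: "real \<times> real \<Rightarrow> real" and c :: real
  assumes S: "open S" and f: "C1_on S f" and g: "C1_on S g"
    and h: "\<And>p. p \<in> S \<Longrightarrow> h p = c * f p + g p"
begin

text \<open>A derivative depends only on values near the point. Since \<open>S\<close> is open,
  nearby points of the horizontal slice stay in \<open>S\<close>, where \<open>h\<close> is the
  linear combination.\<close>

lemma has_partial_x_lincomb:
  assumes "(x, y) \<in> S"
  shows "((\<lambda>t. h (t, y)) has_field_derivative c * partial_x f (x, y) + partial_x g (x, y)) (at x)"
proof -
  have "\<forall>\<^sub>F t in nhds x. h (t, y) = c * f (t, y) + g (t, y)"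
    using eventually_slice_x[OF S assms] by eventually_elim (rule h)
  moreover have "((\<lambda>t. c * f (t, y) + g (t, y)) has_field_derivative
      c * partial_x f (x, y) + partial_x g (x, y)) (at x)"
    by (intro DERIV_add DERIV_cmult C1_on_has_partial_x[OF _ assms] f g)
  ultimately show ?thesis by (simp add: DERIV_cong_ev)
qed

lemma has_partial_y_lincomb:
  assumes "(x, y) \<in> S"
  shows "((\<lambda>t. h (x, t)) has_field_derivative c * partial_y f (x, y) + partial_y g (x, y)) (at y)"
proof -
  have "\<forall>\<^sub>F t in nhds y. h (x, t) = c * f (x, t) + g (x, t)"
    using eventually_slice_y[OF S assms] by eventually_elim (rule h)
  moreover have "((\<lambda>t. c * f (x, t) + g (x, t)) has_field_derivative
      c * partial_y f (x, y) + partial_y g (x, y)) (at y)"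
    by (intro DERIV_add DERIV_cmult C1_on_has_partial_y[OF _ assms] f g)
  ultimately show ?thesis by (simp add: DERIV_cong_ev)
qed

text \<open>The conclusion has the same form as the assumption on \<open>h\<close>, again only on
  \<open>S\<close>, so the result can be applied a second time, with the partial derivatives in
  place of the functions.\<close>

lemma partial_x_lincomb: "p \<in> S \<Longrightarrow> partial_x h p = c * partial_x f p + partial_x g p"
  by (cases p) (simp add: partial_x_eqI has_partial_x_lincomb)

lemma partial_y_lincomb: "p \<in> S \<Longrightarrow> partial_y h p = c * partial_y f p + partial_y g p"
  by (cases p) (simp add: partial_y_eqI has_partial_y_lincomb)

lemma C1_on_lincomb: "C1_on S h"
proof (rule C1_onI)
  have "continuous_on S (\<lambda>p. c * f p + g p)"
    using f g by (auto simp: C1_on_def intro!: continuous_intros)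
  then show "continuous_on S h"
    by (simp add: h cong: continuous_on_cong)
  show "continuous_on S (\<lambda>p. c * partial_x f p + partial_x g p)"
    "continuous_on S (\<lambda>p. c * partial_y f p + partial_y g p)"
    using f g by (auto simp: C1_on_def intro!: continuous_intros)
qed (fact has_partial_x_lincomb has_partial_y_lincomb)+

end

lemma C2_on_lincomb:
  assumes "open S" "C2_on S f" "C2_on S g" "\<And>p. p \<in> S \<Longrightarrow> h p = c * f p + g p"
  shows "C2_on S h"
proof -
  have f: "C1_on S f" "C1_on S (partial_x f)" "C1_on S (partial_y f)"
    and g: "C1_on S g" "C1_on S (partial_x g)" "C1_on S (partial_y g)"
    using assms by (auto simp: C2_on_def)
  note comb = partial_x_lincomb[OF assms(1) f(1) g(1) assms(4)]
    partial_y_lincomb[OF assms(1) f(1) g(1) assms(4)]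
  show ?thesis
    unfolding C2_on_def
    using C1_on_lincomb[OF assms(1) f(1) g(1) assms(4)]
      C1_on_lincomb[OF assms(1) f(2) g(2) comb(1)]
      C1_on_lincomb[OF assms(1) f(3) g(3) comb(2)]
    by blast
qed

context
  fixes a :: real and q :: "real \<times> real \<Rightarrow> real"
  defines "q \<equiv> (\<lambda>(x, y). a * ((x\<^sup>2 + y\<^sup>2) / 2))"
begin

text \<open>Stated as an equality of functions on the whole plane, so that it can be rewritten
  inside a further partial derivative.\<close>

lemma partial_x_quadratic: "partial_x q = (\<lambda>p. a * fst p)"
  unfolding q_def by (rule ext, clarsimp, rule partial_x_eqI) (auto intro!: derivative_eq_intros)

lemma partial_y_quadratic: "partial_y q = (\<lambda>p. a * snd p)"
  unfolding q_def by (rule ext, clarsimp, rule partial_y_eqI) (auto intro!: derivative_eq_intros)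

lemma partial_xx_quadratic: "partial_xx q = (\<lambda>p. a)"
  unfolding partial_x_quadratic
  by (rule ext, clarsimp, rule partial_x_eqI) (auto intro!: derivative_eq_intros)

lemma partial_xy_quadratic: "partial_xy q = (\<lambda>p. 0)"
  unfolding partial_x_quadratic
  by (rule ext, clarsimp, rule partial_y_eqI) (auto intro!: derivative_eq_intros)

lemma partial_yy_quadratic: "partial_yy q = (\<lambda>p. a)"
  unfolding partial_y_quadratic
  by (rule ext, clarsimp, rule partial_y_eqI) (auto intro!: derivative_eq_intros)

lemma C2_on_quadratic: "C2_on S q"
proof -
  have "C1_on S q"
    by (rule C1_onI[where fx = "\<lambda>p. a * fst p" and fy = "\<lambda>p. a * snd p"])
      (auto simp: q_def case_prod_unfold intro!: derivative_eq_intros continuous_intros)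
  moreover have "C1_on S (\<lambda>p. a * fst p)"
    by (rule C1_onI[where fx = "\<lambda>p. a" and fy = "\<lambda>p. 0"])
      (auto intro!: derivative_eq_intros continuous_intros)
  moreover have "C1_on S (\<lambda>p. a * snd p)"
    by (rule C1_onI[where fx = "\<lambda>p. 0" and fy = "\<lambda>p. a"])
      (auto intro!: derivative_eq_intros continuous_intros)
  ultimately show ?thesis
    by (simp add: C2_on_def partial_x_quadratic partial_y_quadratic)
qed

end

theorem lemma18:
  fixes \<Omega> :: "(real \<times> real) set"
    and l1 l2 \<epsilon> :: real
    and F h :: "real \<times> real \<Rightarrow> real"
  assumes "open \<Omega>" and "connected \<Omega>" and "\<Omega> \<noteq> {}"
    and "simply_connected \<Omega>"
    and "\<epsilon> \<in> {-1, 1}"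
    and "l1\<^sup>2 + \<epsilon> * l2\<^sup>2 = 1"
    and "C2_on \<Omega> F"
    and "\<And>p. p \<in> \<Omega> \<Longrightarrow>
           l1 * (partial_xx F p + partial_yy F p)
         + l2 * (1 - \<epsilon> * (partial_xx F p * partial_yy F p - (partial_xy F p)\<^sup>2)) = 0"
    and "\<And>x y. (x, y) \<in> \<Omega> \<Longrightarrow> h (x, y) = l2 * F (x, y) - \<epsilon> * l1 * ((x\<^sup>2 + y\<^sup>2) / 2)"
  shows "C2_on \<Omega> h \<and>
         (\<forall>p \<in> \<Omega>. partial_xx h p * partial_yy h p - (partial_xy h p)\<^sup>2 = 1)"
proof -
  \<comment> \<open>The sign goes into the coefficient, so that \<open>h\<close> becomes
    \<open>c * F + q\<close> with \<open>c = l2\<close> and \<open>q\<close> is the quadratic above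
    with \<open>a = - \<epsilon> * l1\<close>.\<close>
  define q :: "real \<times> real \<Rightarrow> real" where "q = (\<lambda>(x, y). (- \<epsilon> * l1) * ((x\<^sup>2 + y\<^sup>2) / 2))"
  have hq: "h p = l2 * F p + q p" if "p \<in> \<Omega>" for p
    using that assms(9) by (cases p) (simp add: q_def)
  have q: "C2_on \<Omega> q"
    unfolding q_def by (rule C2_on_quadratic)
  have hess_q: "partial_xx q p = - \<epsilon> * l1" "partial_xy q p = 0" "partial_yy q p = - \<epsilon> * l1" for p
    unfolding q_def by (simp_all only: partial_xx_quadratic partial_xy_quadratic partial_yy_quadratic)
  have C1F: "C1_on \<Omega> F" "C1_on \<Omega> (partial_x F)" "C1_on \<Omega> (partial_y F)"
    and C1q: "C1_on \<Omega> q" "C1_on \<Omega> (partial_x q)" "C1_on \<Omega> (partial_y q)"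
    using assms(7) q by (auto simp: C2_on_def)
  \<comment> \<open>These first-order formulas on \<open>\<Omega>\<close> serve as the
    linear-combination hypothesis when differentiating once more.\<close>
  note hx = partial_x_lincomb[OF assms(1) C1F(1) C1q(1) hq]
    and hy = partial_y_lincomb[OF assms(1) C1F(1) C1q(1) hq]
  have "partial_xx h p * partial_yy h p - (partial_xy h p)\<^sup>2 = 1" if p: "p \<in> \<Omega>" for p
  proof -
    have hess_h: "partial_xx h p = l2 * partial_xx F p - \<epsilon> * l1"
      "partial_xy h p = l2 * partial_xy F p"
      "partial_yy h p = l2 * partial_yy F p - \<epsilon> * l1"
      using partial_x_lincomb[OF assms(1) C1F(2) C1q(2) hx p]
        partial_y_lincomb[OF assms(1) C1F(2) C1q(2) hx p]
        partial_y_lincomb[OF assms(1) C1F(3) C1q(3) hy p]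
      by (simp_all add: hess_q)
    have "\<epsilon> * \<epsilon> = 1"
      using assms(5) by auto
    \<comment> \<open>\<open>det Hess h = l2\<^sup>2 det Hess F - \<epsilon> l1 l2 \<Delta>F + l1\<^sup>2\<close>, and \<open>\<epsilon> l2\<close> times the equation for \<open>F\<close> turns the
      first two terms into \<open>\<epsilon> l2\<^sup>2\<close>.\<close>
    then show ?thesis
      unfolding hess_h using assms(6) assms(8)[OF p] by algebra
  qed
  moreover have "C2_on \<Omega> h"
    using assms(1,7) q hq by (rule C2_on_lincomb)
  ultimately show ?thesis by blast
qed

end
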